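(* Let $p\geq 5$ be a prime. Then the following congruence between $p$-integral rational numbers holds modulo $p$: $$\begin{aligned} \sum_{j=2}^{p-3}\frac{B_j}{2^j}B_{p-1-j}\equiv{}& -1+2\Bigg[\frac{1}{2}\bigg(2\sum_{\substack{m=1\\ m\text{ odd}}}^{p-1}H_m\bigg)_0\Bigg]_1+\Bigg[2\bigg(\sum_{\substack{m=1\\ m\text{ odd}}}^{p-1}H_m\bigg)_0\Bigg]_1\\ &+6\sum_{\substack{m=1\\ m\text{ odd}}}^{p-1}H_m+4\sum_{m=1}^{\frac{p-3}{2}}H_{2m}^{(2)}-4\sum_{m=1}^{\frac{p-3}{2}}H_{2m}H_{2m+1}-4\bigg(\sum_{\substack{m=1\\ m\text{ odd}}}^{p-1}H_m\bigg)^2\\ &+2\sum_{m=2}^{\frac{p-3}{2}}\Big(\frac{H_1}{2m-1}+\frac{H_2}{2m-2}+\dots+\frac{H_{2m-1}}{1}\Big)\pmod p . \end{aligned}$$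
   Context: $B_j$ denotes the $j$-th Bernoulli number (generating function $t/(e^t-1)=\sum_{j\ge 0}B_j t^j/j!$). For integers $k\geq 1$ and $n\ge 1$, $H_k=\sum_{i=1}^k\frac1i$ is the harmonic number and $H_k^{(n)}=\sum_{i=1}^k\frac{1}{i^n}$ is the generalized harmonic number. For a $p$-adic integer $x$ (in particular a rational number whose denominator is prime to $p$), $(x)_i$, also written $[x]_i$, denotes the $(i+1)$-th digit of its Hensel expansion $x=\sum_{i=0}^{\infty}(x)_i\,p^i$ with $(x)_i\in\{0,1,\dots,p-1\}$; thus $(x)_0$ is the residue of $x$ modulo $p$ in $\{0,\dots,p-1\}$, regarded as an integer, and $[x]_1$ is the coefficient of $p$. Congruences modulo $p$ are between rational numbers with denominators prime to $p$ (equivalently, in $\mathbb{Z}_p$). An empty sum is $0$ (this occurs for the last sum over $m$ when $p=5$). *)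

theory Defs
  imports Complex_Main "HOL-Computational_Algebra.Computational_Algebra"
begin

definition bernoulli :: "nat \<Rightarrow> rat" where
  "bernoulli n = fact n * fps_nth (fps_X / (fps_exp 1 - 1)) n"

(* The constant term of e^t - 1 vanishes, so the quotient above is division of
   power series with cancellation of a factor t; this lemma confirms that it is
   the intended one. *)
lemma bernoulli_egf:
  "Abs_fps (\<lambda>n. bernoulli n / fact n) * (fps_exp 1 - 1) = fps_X"
proof -
  let ?E = "fps_exp 1 - 1 :: rat fps"
  have nz: "fps_nth ?E 1 \<noteq> 0" by simp
  have sd: "subdegree ?E = 1" by (rule subdegreeI) (simp_all add: nz)
  have "?E \<noteq> 0" using nz by (metis fps_zero_nth)
  then have "?E dvd fps_X" using sd by (subst fps_dvd_iff) simp_all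
  moreover have "Abs_fps (\<lambda>n. bernoulli n / fact n) = fps_X / ?E"
    by (rule fps_ext) (simp add: bernoulli_def)
  ultimately show ?thesis by simp
qed

(* The library's harm lives in real_normed_field, which excludes rat. *)
definition gen_harmonic :: "nat \<Rightarrow> nat \<Rightarrow> rat" where
  "gen_harmonic n k = (\<Sum>i=1..k. 1 / of_nat i ^ n)"

definition harmonic :: "nat \<Rightarrow> rat" where
  "harmonic k = (\<Sum>i=1..k. 1 / of_nat i)"

definition p_integral :: "nat \<Rightarrow> rat \<Rightarrow> bool" where
  "p_integral p x \<longleftrightarrow> coprime (snd (quotient_of x)) (int p)"

(* x and y are p-integral and congruent modulo p ^ n. *)
definition p_cong :: "nat \<Rightarrow> nat \<Rightarrow> rat \<Rightarrow> rat \<Rightarrow> bool" where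
  "p_cong p n x y \<longleftrightarrow> p_integral p x \<and> p_integral p y \<and>
     (\<exists>z. p_integral p z \<and> x - y = of_nat p ^ n * z)"

(* For digits d i < p, the p-adic equality x = (\<Sum>i. d i * p ^ i) means that each
   truncation after n digits is congruent to x modulo p ^ n. *)
definition is_hensel_expansion :: "nat \<Rightarrow> rat \<Rightarrow> (nat \<Rightarrow> nat) \<Rightarrow> bool" where
  "is_hensel_expansion p x d \<longleftrightarrow> (\<forall>i. d i < p) \<and>
     (\<forall>n. p_cong p n x (\<Sum>i<n. of_nat (d i) * of_nat p ^ i))"

definition hensel_digit :: "nat \<Rightarrow> rat \<Rightarrow> nat \<Rightarrow> nat" where
  "hensel_digit p x = (THE d. is_hensel_expansion p x d)"

lemma p_integral_iff:
  assumes "prime p"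
  shows "p_integral p x \<longleftrightarrow> (\<exists>a b. x = of_int a / of_int b \<and> \<not> int p dvd b)"
proof
  obtain a b where q: "quotient_of x = (a, b)" by fastforce
  show "\<exists>a b. x = of_int a / of_int b \<and> \<not> int p dvd b" if pi: "p_integral p x"
  proof -
    have "coprime b (int p)" using pi q by (simp add: p_integral_def)
    moreover have "\<not> is_unit (int p)" using assms prime_gt_1_nat by fastforce
    ultimately have "\<not> int p dvd b" by (meson coprime_common_divisor dvd_refl)
    then show ?thesis using quotient_of_div[OF q] by blast
  qed
  show "p_integral p x" if frac: "\<exists>a b. x = of_int a / of_int b \<and> \<not> int p dvd b"
  proof -
    obtain c e where ce: "x = of_int c / of_int e" "\<not> int p dvd e" using frac by blast
    have e0: "e \<noteq> 0" using ce by auto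
    have b0: "b > 0" using quotient_of_denom_pos[OF q] .
    have "of_int a / of_int b = (of_int c / of_int e :: rat)"
      using ce quotient_of_div[OF q] by simp
    then have "of_int (a * e) = (of_int (c * b) :: rat)"
      using e0 b0 by (simp add: field_simps)
    then have "a * e = c * b" by (simp only: of_int_eq_iff)
    then have "b dvd a * e" by simp
    then have "b dvd e"
      using quotient_of_coprime[OF q] by (simp add: coprime_commute coprime_dvd_mult_right_iff)
    then have "\<not> int p dvd b" using ce dvd_trans by blast
    then have "coprime b (int p)" using assms
      by (metis coprime_commute prime_imp_coprime prime_nat_int_transfer)
    then show ?thesis using q by (simp add: p_integral_def)
  qed
qed

lemma p_integral_of_int:
  assumes "prime p"
  shows "p_integral p (of_int a)"
  unfolding p_integral_iff[OF assms]
  by (rule exI[of _ a], rule exI[of _ 1]) (use assms prime_gt_1_nat in fastforce)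

lemma p_integral_add:
  assumes "prime p" "p_integral p x" "p_integral p y"
  shows "p_integral p (x + y)"
proof -
  obtain a b c d where h: "x = of_int a / of_int b" "\<not> int p dvd b"
      "y = of_int c / of_int d" "\<not> int p dvd d"
    using assms p_integral_iff by metis
  have "b \<noteq> 0" "d \<noteq> 0" using h by auto
  then have "x + y = of_int (a * d + c * b) / of_int (b * d)"
    using h by (simp add: field_simps)
  moreover have "\<not> int p dvd b * d" using h assms(1)
    by (metis prime_dvd_mult_iff prime_nat_int_transfer)
  ultimately show ?thesis using p_integral_iff[OF assms(1)] by blast
qed

lemma p_integral_mult:
  assumes "prime p" "p_integral p x" "p_integral p y"
  shows "p_integral p (x * y)"
proof -
  obtain a b c d where h: "x = of_int a / of_int b" "\<not> int p dvd b"
      "y = of_int c / of_int d" "\<not> int p dvd d"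
    using assms p_integral_iff by metis
  have "x * y = of_int (a * c) / of_int (b * d)" using h by simp
  moreover have "\<not> int p dvd b * d" using h assms(1)
    by (metis prime_dvd_mult_iff prime_nat_int_transfer)
  ultimately show ?thesis using p_integral_iff[OF assms(1)] by blast
qed

lemma p_integral_diff:
  assumes "prime p" "p_integral p x" "p_integral p y"
  shows "p_integral p (x - y)"
  using p_integral_add[OF assms(1,2) p_integral_mult[OF assms(1) p_integral_of_int[OF assms(1), of "-1"] assms(3)]]
  by simp

lemma p_integral_multiple_imp_dvd:
  assumes "prime p" "p_integral p z" "of_int k = of_nat p * z"
  shows "int p dvd k"
proof -
  obtain a b where h: "z = of_int a / of_int b" "\<not> int p dvd b"
    using assms p_integral_iff by metis
  have "b \<noteq> 0" using h by auto
  then have "of_int (k * b) = (of_int (int p * a) :: rat)" using h assms(3)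
    by (simp add: field_simps)
  then have "k * b = int p * a" by (simp only: of_int_eq_iff)
  then have "int p dvd k * b" by simp
  then show ?thesis using h assms(1) by (metis prime_dvd_mult_iff prime_nat_int_transfer)
qed

lemma p_integral_step:
  assumes "prime p" "p_integral p x"
  shows "\<exists>d z. d < p \<and> p_integral p z \<and> x = of_nat d + of_nat p * z"
proof -
  obtain a b where h: "x = of_int a / of_int b" "\<not> int p dvd b"
    using assms p_integral_iff by metis
  have b0: "b \<noteq> 0" using h by auto
  have p0: "p > 0" using assms(1) prime_gt_0_nat by blast
  have "coprime b (int p)"
    using h assms(1) by (metis coprime_commute prime_imp_coprime prime_nat_int_transfer)
  then obtain u v where uv: "u * b + v * int p = 1"
    using bezout_int[of b "int p"] by (auto simp: coprime_iff_gcd_eq_1)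
  define d where "d = nat (a * u mod int p)"
  have d: "int d = a * u mod int p" "d < p" using p0
    by (simp_all add: d_def nat_less_iff)
  have au: "a * u = int d + int p * (a * u div int p)" using d by simp
  have "a = a * (u * b + v * int p)" using uv by simp
  also have "\<dots> = b * (a * u) + int p * (a * v)" by (simp add: algebra_simps)
  also have "b * (a * u) = b * int d + int p * (b * (a * u div int p))"
    by (subst au) (simp only: distrib_left mult.left_commute)
  finally have "a = b * int d + int p * (b * (a * u div int p) + a * v)"
    by (simp only: distrib_left add.assoc)
  then obtain w where w: "a = b * int d + int p * w" by blast
  have "x = of_nat d + of_nat p * (of_int w / of_int b)"
    using b0 h w by (simp add: field_simps)
  moreover have "p_integral p (of_int w / of_int b)"
    using p_integral_iff[OF assms(1)] h by blast
  ultimately show ?thesis using d by blast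
qed

lemma hensel_expansion_ex1:
  assumes "prime p" "p_integral p x"
  shows "\<exists>!d. is_hensel_expansion p x d"
proof -
  have p0: "p > 0" using assms(1) prime_gt_0_nat by blast
  obtain D Z where DZ: "\<And>y. p_integral p y \<Longrightarrow>
      D y < p \<and> p_integral p (Z y) \<and> y = of_nat (D y) + of_nat p * Z y"
    using p_integral_step[OF assms(1)] by metis
  define r where "r n = (Z ^^ n) x" for n
  have r: "p_integral p (r n)" for n
    by (induction n) (use assms DZ in \<open>simp_all add: r_def\<close>)
  have S: "p_integral p (\<Sum>i<n. of_nat (d i) * of_nat p ^ i)" for n and d :: "nat \<Rightarrow> nat"
    using p_integral_of_int[OF assms(1), of "\<Sum>i<n. int (d i) * int p ^ i"] by simp
  have x: "x = (\<Sum>i<n. of_nat (D (r i)) * of_nat p ^ i) + of_nat p ^ n * r n" for n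
  proof (induction n)
    case 0
    then show ?case by (simp add: r_def)
  next
    case (Suc n)
    have "r n = of_nat (D (r n)) + of_nat p * r (Suc n)"
      using DZ[OF r[of n]] by (simp add: r_def)
    then have "of_nat p ^ n * r n =
        of_nat p ^ n * (of_nat (D (r n)) + of_nat p * r (Suc n))"
      by (rule arg_cong)
    also have "\<dots> = of_nat (D (r n)) * of_nat p ^ n + of_nat p ^ Suc n * r (Suc n)"
      by (simp add: algebra_simps)
    finally have "of_nat p ^ n * r n = \<dots>" .
    then show ?case using Suc by simp
  qed
  have ex: "is_hensel_expansion p x (\<lambda>i. D (r i))"
    unfolding is_hensel_expansion_def p_cong_def
  proof (intro conjI allI)
    fix n
    show "\<exists>z. p_integral p z \<and>
        x - (\<Sum>i<n. of_nat (D (r i)) * of_nat p ^ i) = of_nat p ^ n * z"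
      using x[of n] r[of n] by (intro exI[of _ "r n"]) (simp add: diff_eq_eq add.commute)
  qed (use DZ r S assms in auto)
  have un: "d = e" if de: "is_hensel_expansion p x d" "is_hensel_expansion p x e" for d e
  proof
    fix n
    show "d n = e n"
    proof (induction n rule: less_induct)
      case (less n)
      let ?s = "\<lambda>d n. \<Sum>i<n. of_nat (d i) * of_nat p ^ i :: rat"
      obtain z w where zw: "p_integral p z" "x - ?s d (Suc n) = of_nat p ^ Suc n * z"
          "p_integral p w" "x - ?s e (Suc n) = of_nat p ^ Suc n * w"
        using de unfolding is_hensel_expansion_def p_cong_def by meson
      have "?s d n = ?s e n" using less by simp
      then have "(of_nat (d n) - of_nat (e n)) * of_nat p ^ n = of_nat p ^ Suc n * (w - z)"
        using zw by (simp add: algebra_simps)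
      then have "of_nat p ^ n * of_int (int (d n) - int (e n)) =
          of_nat p ^ n * (of_nat p * (w - z))"
        by (simp add: algebra_simps)
      then have "of_int (int (d n) - int (e n)) = of_nat p * (w - z)"
        using p0 by simp
      then have "int p dvd int (d n) - int (e n)"
        using p_integral_multiple_imp_dvd[OF assms(1) p_integral_diff[OF assms(1) zw(3,1)]] by blast
      then have "int (d n) mod int p = int (e n) mod int p" by (simp add: mod_eq_dvd_iff)
      then show "d n = e n" using de unfolding is_hensel_expansion_def by simp
    qed
  qed
  show ?thesis using ex un by blast
qed

end

(* Write A for the sum of (-1)^k / k over 0 < k < p.  Both sides are congruent to 1 - A/2.

   Left-hand side: modulo p the binomial coefficients C(p-1,j) are (-1)^j, so the sum is the
   binomial convolution of B_j / 2^j and B_j.  Its generating function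
   t^2/2 / ((u-1)^2 (u+1)), u = e^(t/2), splits by partial fractions into terms linear in
   Bernoulli generating functions, leaving -p B_(p-1) (1 + q) / 2^(p-1) with the Fermat quotient
   q = (2^(p-1) - 1)/p, and p B_(p-1) = -1, 2q = -A modulo p.

   Right-hand side: the digits are carries and contribute 0 or p.  As
   H_1/(n-1) + ... + H_(n-1)/1 = H_n^2 - H_n^(2), everything else is expressed exactly by S and by
   the sums of H_n^2 and H_n^(2) over odd n; exchanging the order of summation reduces these to A,
   to sums vanishing under k -> p - k, and to the sum W of (-1)^k H_(k-1) / k.
   Finally A^2 = 4 W modulo p, by grouping the pairs (i,j) in the square according to i + j and
   reflecting those with i + j > p. *)
theory Submission
  imports Defs
begin

section \<open>Generating function identities for Bernoulli numbers\<close>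

text \<open>Substitution of ct for t in \<open>bernoulli_egf\<close>.\<close>

lemma bernoulli_egf_scale:
  "Abs_fps (\<lambda>n. c ^ n * (bernoulli n / fact n)) * (fps_exp c - 1) = fps_const c * fps_X"
proof -
  let ?B = "Abs_fps (\<lambda>n. bernoulli n / fact n)" and ?L = "fps_const c * fps_X :: rat fps"
  have "(?B * (fps_exp 1 - 1)) oo ?L = (?B oo ?L) * ((fps_exp 1 - 1) oo ?L)"
    by (rule fps_compose_mult_distrib) simp
  moreover have "?B oo ?L = Abs_fps (\<lambda>n. c ^ n * (bernoulli n / fact n))"
    by (simp add: fps_compose_linear)
  moreover have "(fps_exp 1 - 1) oo ?L = fps_exp c - (1 :: rat fps)"
    by (simp add: fps_compose_sub_distrib)
  ultimately show ?thesis
    by (simp add: bernoulli_egf)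
qed

text \<open>Makes the factors e^(ct) - 1 cancellable, which takes the place of division by
  them.\<close>

lemma fps_exp_minus_1_neq_0: "c \<noteq> 0 \<Longrightarrow> fps_exp c - 1 \<noteq> (0 :: rat fps)"
proof
  assume "c \<noteq> 0" and "fps_exp c - 1 = (0 :: rat fps)"
  then have "fps_nth (fps_exp c - 1) 1 = 0"
    by simp
  with \<open>c \<noteq> 0\<close> show False
    by simp
qed

text \<open>If B(t) = t/(e^t - 1), then B(-t) = B(t) + t; coefficients of odd degree above 1
  therefore equal their negatives.\<close>

lemma bernoulli_odd_eq_0:
  assumes "odd n" "n > 1"
  shows "bernoulli n = 0"
proof -
  let ?B = "Abs_fps (\<lambda>n. bernoulli n / fact n)"
  let ?C = "Abs_fps (\<lambda>n. (-1) ^ n * (bernoulli n / fact n))"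
  let ?E = "fps_exp 1 :: rat fps"
  have inv: "fps_exp (-1) * ?E = 1"
    by (simp flip: fps_exp_add_mult)
  have "?C * (fps_exp (-1) - 1) * ?E = fps_const (-1) * fps_X * ?E"
    by (simp only: bernoulli_egf_scale)
  moreover have "?C * (fps_exp (-1) - 1) * ?E = - (?C * (?E - 1))"
    using inv by algebra
  ultimately have "?C * (?E - 1) = fps_X * ?E"
    by (simp flip: fps_const_neg)
  also have "\<dots> = (fps_X + ?B) * (?E - 1)"
    using bernoulli_egf by (simp add: algebra_simps)
  finally have "?C = fps_X + ?B"
    using fps_exp_minus_1_neq_0[of 1] by simp
  then have "fps_nth ?C n = fps_nth (fps_X + ?B) n"
    by (rule arg_cong)
  then show ?thesis
    using assms by (simp add: fps_X_def)
qed

text \<open>The coefficient of t^(n+1) in B(t) (e^t - 1) = t, multiplied by (n+1)!.\<close>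

lemma bernoulli_recurrence:
  assumes "n \<ge> 1"
  shows "(\<Sum>k\<le>n. of_nat (Suc n choose k) * bernoulli k) = 0"
proof -
  let ?B = "Abs_fps (\<lambda>n. bernoulli n / fact n)"
  have "0 = fact (Suc n) * fps_nth (?B * (fps_exp 1 - 1)) (Suc n)"
    unfolding bernoulli_egf using assms by (simp add: fps_X_def)
  also have "\<dots> = (\<Sum>k\<le>n. fact (Suc n) * (bernoulli k / fact k * (1 / fact (Suc n - k))))"
    by (auto simp: fps_mult_nth atLeast0AtMost sum_distrib_left Suc_diff_le simp del: fact_Suc intro!: sum.cong)
  also have "\<dots> = (\<Sum>k\<le>n. of_nat (Suc n choose k) * bernoulli k)"
    by (rule sum.cong) (auto simp: binomial_fact field_simps simp del: fact_Suc)
  finally show ?thesis ..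
qed

lemma bernoulli_0: "bernoulli 0 = 1"
proof -
  have "fps_nth (Abs_fps (\<lambda>n. bernoulli n / fact n) * (fps_exp 1 - 1)) 1 = fps_nth fps_X 1"
    by (simp only: bernoulli_egf)
  then show ?thesis
    by (simp add: fps_mult_nth)
qed

text \<open>With u = e^(t/2), the series are B = t/(u^2-1) and C = (t/2)/(u-1), and C - t C' =
  (t^2/4) u/(u-1)^2. Dividing by t^2 leaves the partial fractions 2/((u-1)^2 (u+1)) = u/(u-1)^2 -
  1/(u-1) - 1/(u^2-1).\<close>

lemma bernoulli_egf_half_product:
  defines "B \<equiv> Abs_fps (\<lambda>n. bernoulli n / fact n)"
    and "C \<equiv> Abs_fps (\<lambda>n. (1 / 2) ^ n * (bernoulli n / fact n))"
  shows "4 * (C * B) = 4 * (C - fps_X * fps_deriv C) - 2 * (fps_X * C) - fps_X * B"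
proof -
  define u where "u = (fps_exp (1 / 2) :: rat fps)"
  define D where "D = fps_deriv C"
  have uu: "fps_exp 1 = u * u"
    by (simp add: u_def flip: fps_exp_add_mult)
  have B: "B * (u * u - 1) = fps_X"
    using bernoulli_egf by (simp add: B_def uu)
  have half: "2 * fps_const (1 / 2) = (1 :: rat fps)"
    by (simp add: numeral_fps_const)
  have "C * (u - 1) = fps_const (1 / 2) * fps_X"
    unfolding C_def u_def by (rule bernoulli_egf_scale)
  then have eq: "2 * (C * (u - 1)) = fps_X"
    using half by (metis mult.assoc mult_1)
  have "fps_deriv (2 * (C * (u - 1))) = 1"
    unfolding eq by simp
  moreover have "2 * fps_deriv u = u"
    using half by (simp add: u_def flip: mult.assoc)
  ultimately have D: "2 * (D * (u - 1)) + C * u = 1"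
    unfolding D_def by (simp add: algebra_simps)
  have nz: "u - 1 \<noteq> 0" "u * u - 1 \<noteq> 0"
    using fps_exp_minus_1_neq_0[of "1 / 2"] fps_exp_minus_1_neq_0[of 1] uu by (auto simp: u_def)
  define X where "X = (fps_X :: rat fps)"
  \<comment> \<open>Denominators are cleared by the nonzero factor
    \<open>(u - 1) * (u * u - 1)\<close>, cancelled at the end.\<close>
  have "4 * (C * B) * ((u - 1) * (u * u - 1)) = 2 * ((2 * (C * (u - 1))) * (B * (u * u - 1)))"
    by (simp add: algebra_simps)
  also have "\<dots> = 2 * (X * X)"
    unfolding B eq X_def ..
  \<comment> \<open>By \<open>D\<close> the first two terms cancel; they are inserted to bring in
    the derivative. By \<open>eq\<close> and \<open>B\<close> the others are X^2 times the
    numerators u (u+1), u^2 - 1 and u - 1.\<close>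
  also have "\<dots> = 2 * (X * (u * u - 1)) - 2 * (X * (u * u - 1)) * (2 * (D * (u - 1)) + C * u)
      + X * (u * (u + 1)) * (2 * (C * (u - 1))) - X * (u * u - 1) * (2 * (C * (u - 1)))
      - X * (u - 1) * (B * (u * u - 1))"
    unfolding B eq D X_def[symmetric] by (simp add: algebra_simps)
  \<comment> \<open>A ring identity, whose last term vanishes by \<open>eq\<close>.\<close>
  also have "\<dots> = (4 * (C - X * D) - 2 * (X * C) - X * B) * ((u - 1) * (u * u - 1))
      - 2 * ((2 * (C * (u - 1))) - X) * (u * u - 1)"
    by (simp add: algebra_simps)
  also have "\<dots> = (4 * (C - X * D) - 2 * (X * C) - X * B) * ((u - 1) * (u * u - 1))"
    unfolding eq X_def by simp
  finally have "4 * (C * B) * ((u - 1) * (u * u - 1))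
      = (4 * (C - fps_X * D) - 2 * (fps_X * C) - fps_X * B) * ((u - 1) * (u * u - 1))"
    unfolding X_def .
  then show ?thesis
    using nz by (simp add: D_def)
qed

text \<open>Coefficients of t^n in \<open>bernoulli_egf_half_product\<close>, times n!: passing from
  C to C - t C' multiplies the n-th coefficient by 1 - n, and a factor t brings in
  \<open>bernoulli (n - 1)\<close>.\<close>

lemma bernoulli_half_convolution:
  assumes "n \<ge> 1"
  shows "(\<Sum>j\<le>n. of_nat (n choose j) * (bernoulli j / 2 ^ j * bernoulli (n - j)))
    = - (of_nat n - 1) * bernoulli n / 2 ^ n
      - of_nat n * bernoulli (n - 1) * (1 / 2 ^ n + 1 / 4)"
proof -
  let ?B = "Abs_fps (\<lambda>n. bernoulli n / fact n)"
  let ?C = "Abs_fps (\<lambda>n. (1 / 2) ^ n * (bernoulli n / fact n))"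
  obtain m where m: "n = Suc m"
    using assms by (cases n) auto
  have divide_4: "4 * x = z / f \<Longrightarrow> f \<noteq> 0 \<Longrightarrow> f * x = z / 4" for x z f :: rat
    by (simp add: field_simps)
  have "4 * fps_nth (?C * ?B) n
      = 4 * (fps_nth ?C n - fps_nth (fps_X * fps_deriv ?C) n)
        - 2 * fps_nth (fps_X * ?C) n - fps_nth (fps_X * ?B) n"
    using arg_cong[OF bernoulli_egf_half_product, of "\<lambda>f. fps_nth f n"]
    by (simp add: numeral_fps_const)
  also have "\<dots> = 4 * ((1 - of_nat n) * (bernoulli n / 2 ^ n / fact n))
      - (4 / 2 ^ n + 1) * (bernoulli m / fact m)"
    by (simp add: m power_divide left_diff_distrib distrib_right diff_divide_distrib add_divide_distrib del: of_nat_Suc fact_Suc)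
  also have "bernoulli m / fact m = of_nat n * bernoulli m / fact n"
    by (simp add: m)
  also have "4 * ((1 - of_nat n) * (bernoulli n / 2 ^ n / fact n)) - (4 / 2 ^ n + 1) * (of_nat n * bernoulli m / fact n)
     = (4 * ((1 - of_nat n) * (bernoulli n / 2 ^ n)) - (4 / 2 ^ n + 1) * (of_nat n * bernoulli m)) / fact n"
    by (simp add: diff_divide_distrib)
  finally have eq: "fact n * fps_nth (?C * ?B) n = (4 * ((1 - of_nat n) * (bernoulli n / 2 ^ n))
      - (4 / 2 ^ n + 1) * (of_nat n * bernoulli m)) / 4"
    using divide_4[OF _ fact_nonzero] by blast
  have "(\<Sum>j\<le>n. of_nat (n choose j) * (bernoulli j / 2 ^ j * bernoulli (n - j)))
      = fact n * fps_nth (?C * ?B) n"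
    by (auto simp: fps_mult_nth atLeast0AtMost sum_distrib_left binomial_fact power_divide
        intro!: sum.cong)
  also note eq
  also have "(4 * ((1 - of_nat n) * (bernoulli n / 2 ^ n)) - (4 / 2 ^ n + 1) * (of_nat n * bernoulli m)) / 4
      = - (of_nat n - 1) * bernoulli n / 2 ^ n - of_nat n * bernoulli (n - 1) * (1 / 2 ^ n + 1 / 4)"
    by (simp add: m field_simps)
  finally show ?thesis .
qed

section \<open>Exact identities for harmonic sums\<close>

text \<open>If i + j = n + 1, then 1/(i j) = (1/i + 1/j)/(n+1).\<close>

lemma sum_reciprocal_products:
  "(\<Sum>i=1..n. 1 / (of_nat i * of_nat (Suc n - i))) = 2 * harmonic n / (of_nat (Suc n) :: rat)"
proof -
  have "(\<Sum>i=1..n. 1 / (of_nat i * of_nat (Suc n - i) :: rat))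
      = (\<Sum>i=1..n. (1 / of_nat i + 1 / of_nat (Suc n - i)) / of_nat (Suc n))"
  proof (rule sum.cong)
    fix i
    assume "i \<in> {1..n}"
    then obtain j where "Suc n = i + j" "i > 0" "j > 0"
      by (metis atLeastAtMost_iff le_Suc_ex le_imp_less_Suc less_add_same_cancel1 less_le_trans zero_less_one less_imp_le)
    moreover from this have "of_nat i + of_nat j \<noteq> (0 :: rat)"
      by (metis add_gr_0 less_irrefl of_nat_add of_nat_eq_0_iff)
    ultimately show "1 / (of_nat i * of_nat (Suc n - i)) = (1 / of_nat i + 1 / of_nat (Suc n - i)) / (of_nat (Suc n) :: rat)"
      by (simp add: divide_simps del: of_nat_Suc)
  qed simp
  also have "\<dots> = (harmonic n + (\<Sum>i=1..n. 1 / of_nat (Suc n - i))) / of_nat (Suc n)"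
    by (simp add: harmonic_def sum.distrib flip: sum_divide_distrib)
  also have "(\<Sum>i=1..n. 1 / of_nat (Suc n - i) :: rat) = harmonic n"
    unfolding harmonic_def by (rule sum.reindex_bij_witness[of _ "\<lambda>i. Suc n - i" "\<lambda>i. Suc n - i"]) auto
  finally show ?thesis
    by simp
qed

lemma harmonic_0 [simp]: "harmonic 0 = 0"
  by (simp add: harmonic_def)

lemma harmonic_Suc: "harmonic (Suc n) = harmonic n + 1 / of_nat (Suc n)"
  by (simp add: harmonic_def)

lemma gen_harmonic_0 [simp]: "gen_harmonic r 0 = 0"
  by (simp add: gen_harmonic_def)

lemma gen_harmonic_Suc: "gen_harmonic r (Suc n) = gen_harmonic r n + 1 / of_nat (Suc n) ^ r"
  by (simp add: gen_harmonic_def)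

text \<open>The induction step adds 2 H_(n+1)/(n+2) on both sides: on the right as the cross term of
  the square, on the left through H_(n+2-i) = H_(n+1-i) + 1/(n+2-i) and
  \<open>sum_reciprocal_products\<close>.\<close>

lemma harmonic_convolution:
  "(\<Sum>i=1..n. harmonic i / of_nat (Suc n - i)) = harmonic (Suc n) ^ 2 - gen_harmonic 2 (Suc n)"
proof (induction n)
  case 0
  show ?case by (simp add: harmonic_Suc gen_harmonic_Suc)
next
  case (Suc n)
  have flip: "(\<Sum>i=1..k. harmonic i / of_nat (Suc k - i)) = (\<Sum>i=1..k. harmonic (Suc k - i) / of_nat i)" for k
    by (rule sum.reindex_bij_witness[of _ "\<lambda>i. Suc k - i" "\<lambda>i. Suc k - i"]) auto
  have "(\<Sum>i=1..Suc n. harmonic i / of_nat (Suc (Suc n) - i))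
      = (\<Sum>i=1..Suc n. harmonic (Suc n - i) / of_nat i + 1 / (of_nat i * of_nat (Suc (Suc n) - i)))"
    unfolding flip by (rule sum.cong) (auto simp: Suc_diff_le harmonic_Suc add_divide_distrib mult.commute)
  \<comment> \<open>The summand \<open>i = Suc n\<close> drops out of the first sum because H_0 =
    0.\<close>
  also have "\<dots> = (\<Sum>i=1..n. harmonic (Suc n - i) / of_nat i) + 2 * harmonic (Suc n) / of_nat (Suc (Suc n))"
    by (simp only: sum.distrib sum_reciprocal_products) simp
  also have "\<dots> = harmonic (Suc n) ^ 2 - gen_harmonic 2 (Suc n) + 2 * harmonic (Suc n) / of_nat (Suc (Suc n))"
    using Suc.IH flip[of n] by simp
  also have "\<dots> = harmonic (Suc (Suc n)) ^ 2 - gen_harmonic 2 (Suc (Suc n))"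
    unfolding harmonic_Suc[of "Suc n"] gen_harmonic_Suc[of _ "Suc n"]
    by (simp only: power2_sum power_divide power_one) (simp add: mult.commute)
  finally show ?case .
qed

text \<open>The weight counts the m < h with 2m+1 >= k, that is h - floor(k/2). It is 0 at k = 2h,
  which lets the range run up to 2h, later p - 1.\<close>

lemma sum_partial_sums_odd:
  fixes a :: "nat \<Rightarrow> rat"
  shows "(\<Sum>m<h. \<Sum>k=1..2*m+1. a k) = (\<Sum>k=1..2*h. (of_nat (4*h+1) - 2 * of_nat k - (-1) ^ k) / 4 * a k)"
proof (induction h)
  case (Suc h)
  have "(\<Sum>k=1..2 * Suc h. (of_nat (4 * Suc h + 1) - 2 * of_nat k - (-1) ^ k) / 4 * a k)
      = (\<Sum>k=1..2 * h. (of_nat (4 * h + 1) - 2 * of_nat k - (-1) ^ k) / 4 * a k + a k) + a (2 * h + 1)"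
    by (simp add: field_simps)
  also have "\<dots> = (\<Sum>k=1..2 * h. (of_nat (4 * h + 1) - 2 * of_nat k - (-1) ^ k) / 4 * a k) + (\<Sum>k=1..2*h+1. a k)"
    by (simp add: sum.distrib)
  finally show ?case
    using Suc by simp
qed simp

text \<open>Telescoping H_k^2 - H_(k-1)^2 writes the square as a partial sum, the form that
  \<open>sum_partial_sums_odd\<close> takes.\<close>

lemma square_harmonic: "harmonic n ^ 2 = (\<Sum>k=1..n. 2 * harmonic (k - 1) / of_nat k + 1 / of_nat k ^ 2)"
proof (induction n)
  case (Suc n)
  then show ?case
    unfolding harmonic_Suc by (simp add: power2_sum power_divide del: of_nat_Suc)
qed simp

lemma sum_harmonic: "(\<Sum>k=1..n. harmonic (k - 1)) = of_nat n * harmonic n - of_nat n"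
proof (induction n)
  case (Suc n)
  have "of_nat (Suc n) * harmonic (Suc n) = of_nat (Suc n) * harmonic n + 1"
    by (simp add: harmonic_Suc distrib_left del: of_nat_Suc)
  then show ?case
    using Suc by (simp add: algebra_simps)
qed simp

text \<open>After \<open>harmonic_convolution\<close> the three summands for a given m combine
  exactly: 4G - 4H(H+r) + 2(H^2-G) = 2(G+r^2) - 2(H+r)^2, where r = 1/(2m+1) is the step to the odd
  index 2m+1.\<close>

lemma even_index_sums_eq_odd_index_sums:
  fixes h :: nat
  assumes "h \<ge> 2"
  shows "4 * (\<Sum>m=1..h-1. gen_harmonic 2 (2 * m))
       - 4 * (\<Sum>m=1..h-1. harmonic (2 * m) * harmonic (2 * m + 1))
       + 2 * (\<Sum>m=2..h-1. \<Sum>i=1..2*m-1. harmonic i / of_nat (2 * m - i))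
     = 2 * (\<Sum>m<h. gen_harmonic 2 (2 * m + 1)) - 2 * (\<Sum>m<h. harmonic (2 * m + 1) ^ 2) - 2"
proof -
  let ?P = "\<lambda>m. harmonic (2 * m) ^ 2 - gen_harmonic 2 (2 * m)"
  have conv: "(\<Sum>i=1..2*m-1. harmonic i / of_nat (2 * m - i)) = ?P m" if "m \<in> {2..h-1}" for m
  proof -
    have "Suc (2 * m - 1) = 2 * m"
      using that by simp
    then show ?thesis
      using harmonic_convolution[of "2 * m - 1"] by (simp only:)
  qed
  \<comment> \<open>The double sum starts at m = 2; its missing term at m = 1 is the source of the
    constant -2.\<close>
  have "?P 1 = 1"
    by (simp add: numeral_2_eq_2 harmonic_Suc gen_harmonic_Suc power2_eq_square)
  then have D: "(\<Sum>m=2..h-1. \<Sum>i=1..2*m-1. harmonic i / of_nat (2 * m - i)) = (\<Sum>m=1..h-1. ?P m) - 1"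
    using assms conv sum.atLeast_Suc_atMost[of 1 "h - 1" ?P] by (simp flip: numeral_2_eq_2)
  have lessThan: "(\<Sum>m<h. f m) = f 0 + (\<Sum>m=1..h-1. f m)" for f :: "nat \<Rightarrow> rat"
  proof -
    have "{..<h} = insert 0 {1..h-1}"
      using assms by auto
    then show ?thesis by simp
  qed
  have termwise: "4 * gen_harmonic 2 (2 * m) - 4 * (harmonic (2 * m) * harmonic (2 * m + 1)) + 2 * ?P m
      = 2 * gen_harmonic 2 (2 * m + 1) - 2 * harmonic (2 * m + 1) ^ 2" for m
  proof -
    define r :: rat where "r = 1 / of_nat (Suc (2 * m))"
    have "harmonic (2 * m + 1) = harmonic (2 * m) + r"
        "gen_harmonic 2 (2 * m + 1) = gen_harmonic 2 (2 * m) + r ^ 2"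
      by (simp_all add: r_def harmonic_Suc gen_harmonic_Suc power_divide)
    then show ?thesis
      by (simp add: power2_eq_square algebra_simps)
  qed
  have "4 * (\<Sum>m=1..h-1. gen_harmonic 2 (2 * m))
       - 4 * (\<Sum>m=1..h-1. harmonic (2 * m) * harmonic (2 * m + 1))
       + 2 * (\<Sum>m=1..h-1. ?P m)
     = (\<Sum>m=1..h-1. 4 * gen_harmonic 2 (2 * m) - 4 * (harmonic (2 * m) * harmonic (2 * m + 1)) + 2 * ?P m)"
    by (simp add: sum.distrib sum_subtractf sum_distrib_left right_diff_distrib)
  also have "\<dots> = 2 * (\<Sum>m=1..h-1. gen_harmonic 2 (2 * m + 1)) - 2 * (\<Sum>m=1..h-1. harmonic (2 * m + 1) ^ 2)"
    by (simp only: termwise sum_subtractf sum_distrib_left)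
  \<comment> \<open>The added terms at m = 0 cancel, as H_1 = H_1^(2) = 1.\<close>
  also have "\<dots> = 2 * (\<Sum>m<h. gen_harmonic 2 (2 * m + 1)) - 2 * (\<Sum>m<h. harmonic (2 * m + 1) ^ 2)"
    unfolding lessThan by (simp add: harmonic_Suc gen_harmonic_Suc)
  finally show ?thesis
    unfolding D by (simp add: algebra_simps)
qed

text \<open>Double counting of the pairs with i + j <= N by rows and by diagonals; the induction
  step adds the diagonal i + j = N + 1.\<close>

lemma sum_triangle_diagonals:
  fixes g :: "nat \<Rightarrow> nat \<Rightarrow> rat"
  shows "(\<Sum>i=1..N. \<Sum>j=1..N-i. g i j) = (\<Sum>n=1..N. \<Sum>i=1..n-1. g i (n - i))"
proof (induction N)
  case (Suc N)
  have "(\<Sum>i=1..Suc N. \<Sum>j=1..Suc N-i. g i j) = (\<Sum>i=1..N. (\<Sum>j=1..N-i. g i j) + g i (Suc N - i))"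
    by (auto simp: Suc_diff_le intro!: sum.cong)
  with Suc show ?case
    by (simp add: sum.distrib)
qed simp

section \<open>Arithmetic of p-integral rationals and congruences modulo p\<close>

locale odd_prime =
  fixes p :: nat
  assumes prime_p: "prime p" and odd_p: "odd p"
begin

text \<open>With p fixed, congruence becomes an infix relation for chained calculations; it includes
  p-integrality of both sides.\<close>

definition pcong :: "rat \<Rightarrow> rat \<Rightarrow> bool" (infix "\<simeq>" 50) where
  "x \<simeq> y \<longleftrightarrow> p_cong p 1 x y"

lemma p_gt_2: "p > 2"
  using odd_p prime_p prime_ge_2_nat[of p] by (cases "p = 2") auto

lemma p_integral_of_nat: "p_integral p (of_nat n)"
  using p_integral_of_int[OF prime_p, of "int n"] by simp

lemma p_integral_numeral: "p_integral p (numeral n)"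
  using p_integral_of_nat[of "numeral n"] by simp

lemma p_integral_0: "p_integral p 0"
  using p_integral_of_nat[of 0] by simp

lemma p_integral_1: "p_integral p 1"
  using p_integral_of_nat[of 1] by simp

lemma p_integral_minus: "p_integral p x \<Longrightarrow> p_integral p (- x)"
  using p_integral_diff[OF prime_p p_integral_0] by fastforce

lemma p_integral_power: "p_integral p x \<Longrightarrow> p_integral p (x ^ n)"
  by (induction n) (simp_all add: p_integral_1 p_integral_mult[OF prime_p])

lemma p_integral_sum: "(\<And>i. i \<in> A \<Longrightarrow> p_integral p (f i)) \<Longrightarrow> p_integral p (sum f A)"
  by (induction A rule: infinite_finite_induct) (simp_all add: p_integral_0 p_integral_add[OF prime_p])

lemma p_integral_divide_of_nat:
  assumes "p_integral p x" "\<not> p dvd k"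
  shows "p_integral p (x / of_nat k)"
proof -
  have "p_integral p (1 / of_nat k)"
    unfolding p_integral_iff[OF prime_p]
    by (rule exI[of _ 1], rule exI[of _ "int k"]) (use assms in auto)
  then have "p_integral p (x * (1 / of_nat k))"
    by (rule p_integral_mult[OF prime_p assms(1)])
  then show ?thesis
    by simp
qed

lemma p_integral_divide_lt: "p_integral p x \<Longrightarrow> 0 < k \<Longrightarrow> k < p \<Longrightarrow> p_integral p (x / of_nat k)"
  using p_integral_divide_of_nat nat_dvd_not_less by blast

lemma p_integral_divide_2_power:
  assumes "p_integral p x"
  shows "p_integral p (x / 2 ^ n)"
proof -
  have "\<not> p dvd 2 ^ n"
    using p_gt_2 prime_dvd_power[OF prime_p, of 2 n] nat_dvd_not_less[of 2 p] by auto
  from p_integral_divide_of_nat[OF assms this] show ?thesis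
    by simp
qed

lemma p_integral_divide_2: "p_integral p x \<Longrightarrow> p_integral p (x / 2)"
  using p_integral_divide_2_power[of x 1] by simp

lemma p_integral_divide_4: "p_integral p x \<Longrightarrow> p_integral p (x / 4)"
  using p_integral_divide_2_power[of x 2] by simp

text \<open>Division by 2 and its powers is included because p is odd; other divisors carry side
  conditions and are treated separately.\<close>

lemmas p_integral_intros =
  p_integral_of_nat p_integral_numeral p_integral_0 p_integral_1
  p_integral_minus p_integral_add[OF prime_p] p_integral_diff[OF prime_p] p_integral_mult[OF prime_p]
  p_integral_power p_integral_sum p_integral_divide_2 p_integral_divide_4
  p_integral_divide_2_power

lemma pcong_integral:
  assumes "x \<simeq> y"
  shows "p_integral p x" "p_integral p y"
  using assms by (auto simp: pcong_def p_cong_def)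

lemma pcongI:
  "p_integral p y \<Longrightarrow> p_integral p z \<Longrightarrow> x = y + of_nat p * z \<Longrightarrow> x \<simeq> y"
  by (auto simp: pcong_def p_cong_def intro!: p_integral_intros)

lemma pcongE:
  assumes "x \<simeq> y"
  obtains z where "p_integral p y" "p_integral p z" "x = y + of_nat p * z"
  using assms by (auto simp: pcong_def p_cong_def algebra_simps)

lemma pcong_refl: "p_integral p x \<Longrightarrow> x \<simeq> x"
  by (rule pcongI[where z = 0]) (auto intro: p_integral_0)

lemma pcong_sym: "x \<simeq> y \<Longrightarrow> y \<simeq> x"
  by (elim pcongE, rule_tac z = "- z" in pcongI) (auto intro!: p_integral_intros)

lemma pcong_trans [trans]: "x \<simeq> y \<Longrightarrow> y \<simeq> z \<Longrightarrow> x \<simeq> z"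
  by (elim pcongE, rule_tac z = "za + zaa" in pcongI)
    (auto intro!: p_integral_intros simp: algebra_simps)

(* The generic substitution rules for mixed chains make higher-order unification explode on the
   large sums below. *)
lemma eq_pcong_trans [trans]: "x = y \<Longrightarrow> y \<simeq> z \<Longrightarrow> x \<simeq> z"
  by simp

lemma pcong_eq_trans [trans]: "x \<simeq> y \<Longrightarrow> y = z \<Longrightarrow> x \<simeq> z"
  by simp

lemma pcong_add: "x \<simeq> y \<Longrightarrow> x' \<simeq> y' \<Longrightarrow> x + x' \<simeq> y + y'"
  by (elim pcongE, rule_tac z = "z + za" in pcongI)
    (auto intro!: p_integral_intros simp: algebra_simps)

lemma pcong_mult:
  assumes "x \<simeq> y" "x' \<simeq> y'"
  shows "x * x' \<simeq> y * y'"
proof -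
  from assms(1) obtain z where z: "p_integral p y" "p_integral p z" "x = y + of_nat p * z"
    by (rule pcongE)
  from assms(2) obtain z' where z': "p_integral p y'" "p_integral p z'" "x' = y' + of_nat p * z'"
    by (rule pcongE)
  show ?thesis
    using z z'
    by (intro pcongI[where z = "z * y' + y * z' + of_nat p * z * z'"] p_integral_intros)
      (auto simp: algebra_simps)
qed

lemma pcong_mult_left: "p_integral p c \<Longrightarrow> x \<simeq> y \<Longrightarrow> c * x \<simeq> c * y"
  by (intro pcong_mult pcong_refl)

lemma pcong_minus: "x \<simeq> y \<Longrightarrow> - x \<simeq> - y"
  using pcong_mult_left[of "- 1" x y] by (simp add: p_integral_intros)

lemma pcong_diff: "x \<simeq> y \<Longrightarrow> x' \<simeq> y' \<Longrightarrow> x - x' \<simeq> y - y'"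
  using pcong_add[OF _ pcong_minus] by fastforce

lemma pcong_power: "x \<simeq> y \<Longrightarrow> x ^ n \<simeq> y ^ n"
  by (induction n) (auto intro: pcong_mult pcong_refl p_integral_1)

lemma pcong_sum: "(\<And>i. i \<in> A \<Longrightarrow> f i \<simeq> g i) \<Longrightarrow> sum f A \<simeq> sum g A"
  by (induction A rule: infinite_finite_induct) (simp_all add: pcong_add pcong_refl p_integral_0)

lemma pcong_0_mult: "p_integral p x \<Longrightarrow> of_nat p * x \<simeq> 0"
  by (rule pcongI[where z = x]) (auto intro: p_integral_0)

lemma pcong_0_cancel:
  assumes "of_nat k * x \<simeq> 0" "\<not> p dvd k"
  shows "x \<simeq> 0"
proof -
  have "p_integral p (1 / of_nat k)"
    using assms(2) by (intro p_integral_divide_of_nat p_integral_1)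
  from pcong_mult_left[OF this assms(1)] show ?thesis
    using assms(2) by (auto split: if_splits)
qed

section \<open>Harmonic sums modulo p under the reflection k -> p - k\<close>

text \<open>1/(p-i) + 1/i = p/(i (p-i)), and the cofactor of p is p-integral.\<close>

lemma pcong_reciprocal_diff:
  assumes "0 < i" "i < p"
  shows "1 / of_nat (p - i) \<simeq> - (1 / of_nat i)"
proof (rule pcongI)
  show "p_integral p (- (1 / of_nat i))"
    using assms by (intro p_integral_intros p_integral_divide_lt)
  show "p_integral p (1 / of_nat (p - i) / of_nat i)"
    using assms by (intro p_integral_intros p_integral_divide_lt) auto
  have "of_nat p = of_nat (p - i) + (of_nat i :: rat)"
    using assms by (simp flip: of_nat_add)
  then show "1 / of_nat (p - i) = - (1 / of_nat i) + of_nat p * (1 / of_nat (p - i) / of_nat i :: rat)"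
    using assms by (simp add: field_simps del: of_nat_diff)
qed

lemma minus_one_power_diff: "i \<le> p \<Longrightarrow> (-1) ^ (p - i) = - ((-1) ^ i :: rat)"
  using odd_p by (cases "even i") auto

lemma sum_reflect: "(\<Sum>i=1..p-1. f (p - i)) = (\<Sum>i=1..p-1. f i)"
  by (rule sum.reindex_bij_witness[of _ "\<lambda>i. p - i" "\<lambda>i. p - i"]) auto

text \<open>Twice the sum pairs \<open>f i\<close> with \<open>f (p - i)\<close>, and 2 is
  invertible modulo the odd prime.\<close>

lemma sum_antisymmetric_pcong_0:
  assumes "\<And>i. 0 < i \<Longrightarrow> i < p \<Longrightarrow> f (p - i) \<simeq> - f i"
  shows "(\<Sum>i=1..p-1. f i) \<simeq> 0"
proof (rule pcong_0_cancel)
  have "of_nat 2 * (\<Sum>i=1..p-1. f i) = (\<Sum>i=1..p-1. f (p - i) + f i)"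
    using sum_reflect[of f] by (simp add: sum.distrib)
  also have "\<dots> \<simeq> (\<Sum>i=1..p-1. - f i + f i)"
  proof (rule pcong_sum)
    fix i
    assume "i \<in> {1..p-1}"
    then have "f (p - i) \<simeq> - f i"
      using assms by auto
    then show "f (p - i) + f i \<simeq> - f i + f i"
      using pcong_integral(2)[of "f (p - i)" "- f i"] p_integral_minus[of "- f i"]
      by (intro pcong_add pcong_refl) simp_all
  qed
  finally show "of_nat 2 * (\<Sum>i=1..p-1. f i) \<simeq> 0"
    by simp
  show "\<not> p dvd 2"
    using p_gt_2 by (simp add: nat_dvd_not_less)
qed

lemma p_integral_gen_harmonic:
  assumes "n < p"
  shows "p_integral p (gen_harmonic r n)"
proof -
  have "p_integral p ((1 / of_nat i) ^ r)" if "i \<in> {1..n}" for i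
    using that assms by (intro p_integral_power p_integral_divide_lt p_integral_1) auto
  then show ?thesis
    unfolding gen_harmonic_def by (intro p_integral_sum) (simp add: power_divide)
qed

lemma harmonic_pcong_0: "harmonic (p - 1) \<simeq> 0"
  unfolding harmonic_def by (rule sum_antisymmetric_pcong_0) (rule pcong_reciprocal_diff)

lemma pcong_reciprocal_square_diff:
  assumes "0 < i" "i < p"
  shows "1 / of_nat (p - i) ^ 2 \<simeq> 1 / of_nat i ^ 2"
  using pcong_power[OF pcong_reciprocal_diff[OF assms], of 2] by (simp add: power_divide)

text \<open>Reflection preserves 1/k^2 modulo p but flips the sign (-1)^k, p being odd.\<close>

lemma alternating_square_sum_pcong_0: "(\<Sum>k=1..p-1. (-1) ^ k / of_nat k ^ 2) \<simeq> 0"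
proof (rule sum_antisymmetric_pcong_0)
  fix i
  assume i: "0 < i" "i < p"
  have "(-1) ^ (p - i) / of_nat (p - i) ^ 2 = - ((-1) ^ i) * (1 / of_nat (p - i) ^ 2 :: rat)"
    using i by (simp only: minus_one_power_diff less_imp_le) simp
  also have "\<dots> \<simeq> - ((-1) ^ i) * (1 / of_nat i ^ 2)"
    using pcong_reciprocal_square_diff[OF i] by (intro pcong_mult_left p_integral_intros)
  finally show "(-1) ^ (p - i) / of_nat (p - i) ^ 2 \<simeq> - ((-1) ^ i / of_nat i ^ 2)"
    by simp
qed

text \<open>Adding the alternating sum doubles the even terms and removes the odd ones; 2/(2i)^2 =
  (1/2)/i^2.\<close>

lemma gen_harmonic_2_half:
  "gen_harmonic 2 (2 * n) + (\<Sum>k=1..2*n. (-1) ^ k / of_nat k ^ 2) = gen_harmonic 2 n / 2"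
proof (induction n)
  case (Suc n)
  have "1 / (2 + 2 * of_nat n) ^ 2 = 1 / (1 + of_nat n) ^ 2 / (4 :: rat)"
    by (simp add: power2_eq_square field_simps)
  with Suc show ?case
    by (simp add: gen_harmonic_Suc)
qed simp

text \<open>Put G_n = H_n^(2) and p = 2h + 1. Reflection gives G_(2h) = 2 G_h modulo p, while
  \<open>gen_harmonic_2_half\<close> and the vanishing alternating sum give G_h = 2 G_(2h). Hence 3
  G_(2h) = 0 modulo p, and p > 3.\<close>

lemma gen_harmonic_2_pcong_0:
  assumes "p > 3"
  shows "gen_harmonic 2 (p - 1) \<simeq> 0"
proof -
  define h where "h = p div 2"
  have h: "p = 2 * h + 1"
    using odd_p by (simp add: h_def)
  let ?G = "gen_harmonic 2"
  have "?G (2 * h) = (\<Sum>i=1..h. 1 / of_nat i ^ 2) + (\<Sum>i=1..h. 1 / of_nat (p - i) ^ 2)"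
  proof -
    have "(\<Sum>i=1..h. 1 / of_nat (p - i) ^ 2) = (\<Sum>i=h+1..2*h. 1 / of_nat i ^ 2 :: rat)"
      by (rule sum.reindex_bij_witness[of _ "\<lambda>i. p - i" "\<lambda>i. p - i"]) (auto simp: h)
    moreover have "{1..2*h} = {1..h} \<union> {h+1..2*h}"
      by auto
    ultimately show ?thesis
      unfolding gen_harmonic_def by (simp add: sum.union_disjoint)
  qed
  also have "\<dots> \<simeq> (\<Sum>i=1..h. 1 / of_nat i ^ 2) + (\<Sum>i=1..h. 1 / of_nat i ^ 2)"
    using pcong_reciprocal_square_diff p_integral_gen_harmonic[of h 2] h
    by (intro pcong_add pcong_refl pcong_sum) (auto simp: gen_harmonic_def)
  also have "\<dots> = 4 * (?G (2 * h) + (\<Sum>k=1..2*h. (-1) ^ k / of_nat k ^ 2))"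
    unfolding gen_harmonic_2_half by (simp add: gen_harmonic_def)
  also have "\<dots> \<simeq> 4 * (?G (2 * h) + 0)"
    using alternating_square_sum_pcong_0 p_integral_gen_harmonic[of "2 * h" 2] h
    by (intro pcong_mult_left p_integral_intros pcong_add pcong_refl) auto
  finally have "?G (2 * h) - ?G (2 * h) \<simeq> 4 * (?G (2 * h) + 0) - ?G (2 * h)"
    using p_integral_gen_harmonic[of "2 * h" 2] h by (intro pcong_diff pcong_refl) auto
  then have "of_nat 3 * ?G (2 * h) \<simeq> 0"
    using pcong_sym by fastforce
  moreover have "\<not> p dvd 3"
    using assms by (simp add: nat_dvd_not_less)
  ultimately have "?G (2 * h) \<simeq> 0"
    by (rule pcong_0_cancel)
  then show ?thesis
    by (simp add: h)
qed

text \<open>The map (i,j) -> (p-i,p-j) preserves \<open>g\<close> modulo p and exchanges i + j < p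
  with i + j > p. So the square is 2 \<open>?T\<close> plus the diagonal i + j = p, which is
  H_(p-1)^(2) and vanishes.\<close>

lemma alternating_harmonic_square:
  assumes "p > 3"
  shows "(\<Sum>k=1..p-1. (-1) ^ k / of_nat k) ^ 2
    \<simeq> 4 * (\<Sum>k=1..p-1. (-1) ^ k * harmonic (k - 1) / of_nat k)"
proof -
  define g :: "nat \<Rightarrow> nat \<Rightarrow> rat"
    where "g i j = (-1) ^ (i + j) * (1 / of_nat i) * (1 / of_nat j)" for i j
  have g_cong: "g (p - i) (p - j) \<simeq> g i j" and g_int: "p_integral p (g i j)"
    if "0 < i" "i < p" "0 < j" "j < p" for i j
  proof -
    have "g (p - i) (p - j) = (-1) ^ (i + j) * (1 / of_nat (p - i)) * (1 / of_nat (p - j))"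
      unfolding g_def power_add using that minus_one_power_diff[of i] minus_one_power_diff[of j] by simp
    also have "\<dots> \<simeq> (-1) ^ (i + j) * (- (1 / of_nat i)) * (- (1 / of_nat j))"
    proof -
      have "p_integral p ((-1) ^ (i + j))"
        by (intro p_integral_power p_integral_minus p_integral_1)
      then show ?thesis
        by (rule pcong_mult[OF pcong_mult[OF pcong_refl pcong_reciprocal_diff[OF that(1,2)]]
          pcong_reciprocal_diff[OF that(3,4)]])
    qed
    finally show "g (p - i) (p - j) \<simeq> g i j"
      by (simp add: g_def)
    then show "p_integral p (g i j)"
      by (rule pcong_integral)
  qed
  let ?T = "\<Sum>i=1..p-1. \<Sum>j=1..p-1-i. g i j"
  have T_int: "p_integral p ?T"
    by (intro p_integral_sum g_int) auto
  have "(\<Sum>k=1..p-1. (-1) ^ k / of_nat k) ^ 2 = (\<Sum>i=1..p-1. \<Sum>j=1..p-1. g i j)"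
    by (simp add: power2_eq_square sum_product g_def power_add)
  also have "\<dots> = (\<Sum>i=1..p-1. (\<Sum>j=1..p-1-i. g i j) + g i (p - i) + (\<Sum>j=p-i+1..p-1. g i j))"
  proof (rule sum.cong)
    fix i
    assume "i \<in> {1..p-1}"
    then have "{1..p-1} = insert (p - i) {1..p-1-i} \<union> {p-i+1..p-1}" "p - i \<notin> {1..p-1-i}"
      by auto
    then show "(\<Sum>j=1..p-1. g i j) = (\<Sum>j=1..p-1-i. g i j) + g i (p - i) + (\<Sum>j=p-i+1..p-1. g i j)"
      by (simp add: sum.union_disjoint)
  qed simp
  also have "\<dots> = ?T + (\<Sum>i=1..p-1. g i (p - i)) + (\<Sum>i=1..p-1. \<Sum>j=p-i+1..p-1. g i j)"
    by (simp only: sum.distrib)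
  \<comment> \<open>Reflecting first i, then j, carries the triangle i + j > p to i + j < p.\<close>
  also have "(\<Sum>i=1..p-1. \<Sum>j=p-i+1..p-1. g i j) = (\<Sum>i=1..p-1. \<Sum>j=p-(p-i)+1..p-1. g (p - i) j)"
    by (rule sum_reflect[symmetric])
  also have "\<dots> = (\<Sum>i=1..p-1. \<Sum>j=1..p-1-i. g (p - i) (p - j))"
  proof (rule sum.cong)
    fix i
    assume "i \<in> {1..p-1}"
    then show "(\<Sum>j=p-(p-i)+1..p-1. g (p - i) j) = (\<Sum>j=1..p-1-i. g (p - i) (p - j))"
      by (intro sum.reindex_bij_witness[of _ "\<lambda>j. p - j" "\<lambda>j. p - j"]) auto
  qed simp
  also have "?T + (\<Sum>i=1..p-1. g i (p - i)) + \<dots> \<simeq> ?T + (\<Sum>i=1..p-1. 1 / of_nat i ^ 2) + ?T"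
  proof (intro pcong_add pcong_sum)
    fix i
    assume "i \<in> {1..p-1}"
    then have i: "0 < i" "i < p"
      by auto
    \<comment> \<open>On i + j = p the sign is (-1)^p = -1; a second minus sign comes from
      1/(p-i).\<close>
    have "g i (p - i) = - (1 / of_nat i) * (1 / of_nat (p - i))"
      using i odd_p by (simp add: g_def)
    also have "\<dots> \<simeq> - (1 / of_nat i) * (- (1 / of_nat i))"
      using i by (intro pcong_mult_left pcong_reciprocal_diff p_integral_intros p_integral_divide_lt)
    finally show "g i (p - i) \<simeq> 1 / of_nat i ^ 2"
      by (simp add: power2_eq_square)
  next
    fix i j
    assume "i \<in> {1..p-1}" "j \<in> {1..p-1-i}"
    then show "g (p - i) (p - j) \<simeq> g i j"
      by (intro g_cong) auto
  qed (auto intro!: pcong_refl g_int)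
  also have "\<dots> = 2 * ?T + gen_harmonic 2 (p - 1)"
    by (simp add: gen_harmonic_def)
  also have "\<dots> \<simeq> 2 * ?T + 0"
    using gen_harmonic_2_pcong_0[OF assms]
    by (intro pcong_add pcong_refl p_integral_mult[OF prime_p] p_integral_numeral T_int)
  \<comment> \<open>On the diagonal i + j = n the sign is constant, and
    \<open>sum_reciprocal_products\<close> evaluates the rest.\<close>
  also have "?T = (\<Sum>n=1..p-1. \<Sum>i=1..n-1. g i (n - i))"
    by (rule sum_triangle_diagonals)
  also have "\<dots> = (\<Sum>n=1..p-1. 2 * ((-1) ^ n * harmonic (n - 1) / of_nat n))"
  proof (rule sum.cong)
    fix n
    assume "n \<in> {1..p-1}"
    then have n: "Suc (n - 1) = n"
      by simp
    have "(\<Sum>i=1..n-1. g i (n - i)) = (-1) ^ n * (\<Sum>i=1..n-1. 1 / (of_nat i * of_nat (n - i)))"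
      by (auto simp: g_def sum_distrib_left intro!: sum.cong)
    also have "\<dots> = 2 * ((-1) ^ n * harmonic (n - 1) / of_nat n)"
      using sum_reciprocal_products[of "n - 1"] unfolding n by simp
    finally show "(\<Sum>i=1..n-1. g i (n - i)) = 2 * ((-1) ^ n * harmonic (n - 1) / of_nat n)" .
  qed simp
  finally show ?thesis
    by (simp add: sum_distrib_left)
qed

section \<open>Digits of Hensel expansions\<close>

lemma hensel_expansion_hensel_digit:
  "p_integral p x \<Longrightarrow> is_hensel_expansion p x (hensel_digit p x)"
  unfolding hensel_digit_def by (rule hensel_expansion_ex1[OF prime_p, THEN theI'])

lemma hensel_digit_less: "p_integral p x \<Longrightarrow> hensel_digit p x i < p"
  using hensel_expansion_hensel_digit by (auto simp: is_hensel_expansion_def)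

lemma hensel_digit_0_pcong:
  assumes "p_integral p x"
  shows "x \<simeq> of_nat (hensel_digit p x 0)"
proof -
  have "p_cong p 1 x (\<Sum>i<1. of_nat (hensel_digit p x i) * of_nat p ^ i)"
    using hensel_expansion_hensel_digit[OF assms] unfolding is_hensel_expansion_def by blast
  then show ?thesis
    by (simp add: pcong_def)
qed

lemma of_nat_pcong_imp_eq:
  assumes "of_nat a \<simeq> of_nat b" "a < p" "b < p"
  shows "a = b"
proof -
  obtain z where "p_integral p z" "of_nat a = of_nat b + of_nat p * z"
    using assms(1) by (rule pcongE)
  then have "int p dvd int a - int b"
    by (intro p_integral_multiple_imp_dvd[OF prime_p, of z]) auto
  then have "int a mod int p = int b mod int p"
    by (simp add: mod_eq_dvd_iff)
  with assms(2,3) show ?thesis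
    by simp
qed

text \<open>The first two digits depend only on x modulo p^2, so they can be read off from any such
  representation with p-integral remainder.\<close>

lemma hensel_digit_1_eq:
  assumes "a < p" "b < p" "p_integral p z" and x: "x = of_nat a + of_nat p * of_nat b + of_nat p ^ 2 * z"
  shows "hensel_digit p x 1 = b"
proof -
  let ?d = "hensel_digit p x"
  have "x \<simeq> of_nat a"
    unfolding x using assms(3)
    by (intro pcongI[of _ "of_nat b + of_nat p * z"])
      (auto intro!: p_integral_intros simp: power2_eq_square algebra_simps)
  then have int: "p_integral p x"
    by (rule pcong_integral)
  have "of_nat (?d 0) \<simeq> of_nat a"
    using pcong_sym[OF hensel_digit_0_pcong[OF int]] \<open>x \<simeq> of_nat a\<close> by (rule pcong_trans)
  then have d0: "?d 0 = a"
    using of_nat_pcong_imp_eq hensel_digit_less[OF int] assms(1) by blast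
  have "p_cong p 2 x (\<Sum>i<2. of_nat (?d i) * of_nat p ^ i)"
    using hensel_expansion_hensel_digit[OF int] unfolding is_hensel_expansion_def by blast
  then obtain w where w: "p_integral p w" "x - (of_nat a + of_nat (?d 1) * of_nat p) = of_nat p ^ 2 * w"
    by (auto simp: p_cong_def numeral_2_eq_2 d0)
  then have "of_nat p * of_nat (?d 1) = of_nat p * (of_nat b + of_nat p * (z - w) :: rat)"
    unfolding x by (simp add: power2_eq_square algebra_simps)
  then have "of_nat (?d 1) = of_nat b + of_nat p * (z - w)"
    using p_gt_2 by simp
  then have "of_nat (?d 1) \<simeq> of_nat b"
    using w(1) assms(3) by (intro pcongI[of _ "z - w"]) (auto intro!: p_integral_intros)
  then show ?thesis
    using of_nat_pcong_imp_eq hensel_digit_less[OF int] assms(2) by blast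
qed

text \<open>Let s and a be the residues of S and 2S. If 2s < p, then a = 2s and both digits are 0.
  Otherwise a = 2s - p, and with p = 2h + 1 the digits are h and 1, so the total is 2h + 1 =
  p.\<close>

lemma hensel_carries_pcong_0:
  assumes "p_integral p S"
  shows "2 * of_nat (hensel_digit p (1 / 2 * of_nat (hensel_digit p (2 * S) 0)) 1)
    + of_nat (hensel_digit p (2 * of_nat (hensel_digit p S 0)) 1) \<simeq> 0"
proof -
  define s where "s = hensel_digit p S 0"
  define a where "a = hensel_digit p (2 * S) 0"
  have int2: "p_integral p (2 * S)"
    using assms by (intro p_integral_intros)
  have less: "s < p" "a < p"
    unfolding s_def a_def using assms int2 by (auto intro: hensel_digit_less)
  have "of_nat a \<simeq> 2 * S"
    unfolding a_def using hensel_digit_0_pcong[OF int2] by (rule pcong_sym)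
  also have "\<dots> \<simeq> 2 * of_nat s"
    unfolding s_def using hensel_digit_0_pcong[OF assms] by (intro pcong_mult_left p_integral_numeral)
  finally have as: "of_nat a \<simeq> of_nat (2 * s)"
    by simp
  show ?thesis
  proof (cases "2 * s < p")
    case True
    then have a: "a = 2 * s"
      using of_nat_pcong_imp_eq as less by blast
    have "hensel_digit p (1 / 2 * of_nat a) 1 = 0"
      using less a p_gt_2 by (intro hensel_digit_1_eq[of s _ 0]) (auto intro: p_integral_0)
    moreover have "hensel_digit p (2 * of_nat s) 1 = 0"
      using less a p_gt_2 by (intro hensel_digit_1_eq[of a _ 0]) (auto intro: p_integral_0)
    ultimately show ?thesis
      by (simp add: s_def a_def pcong_refl p_integral_0)
  next
    case False
    define h where "h = p div 2"
    have h: "p = 2 * h + 1"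
      using odd_p by (simp add: h_def)
    have "of_nat (2 * s) \<simeq> of_nat (2 * s - p)"
      using False by (intro pcongI[of _ 1]) (auto intro: p_integral_intros simp flip: of_nat_add)
    with as have "of_nat a \<simeq> of_nat (2 * s - p)"
      by (rule pcong_trans)
    then have a: "2 * s = a + p"
      using of_nat_pcong_imp_eq[of a "2 * s - p"] less False by simp
    then have a': "2 * of_nat s = of_nat a + (of_nat p :: rat)"
      by (metis of_nat_add of_nat_mult of_nat_numeral)
    have p': "of_nat p = 2 * of_nat h + (1 :: rat)"
      using h by simp
    \<comment> \<open>The factor p - 2h is 1; this yields a/2 = s - p/2 = s + h p - p^2/2, which
      exhibits the digits s and h.\<close>
    have "of_nat a + of_nat p = of_nat a + of_nat p * (of_nat p - 2 * of_nat h :: rat)"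
      unfolding p' by simp
    then have "1 / 2 * of_nat a = of_nat s + of_nat p * of_nat h + of_nat p ^ 2 * (- (1 / 2) :: rat)"
      unfolding power2_eq_square a'[symmetric] by (simp add: algebra_simps)
    then have "hensel_digit p (1 / 2 * of_nat a) 1 = h"
      using less h by (intro hensel_digit_1_eq[of s h "- (1 / 2)"] p_integral_intros) auto
    moreover have "hensel_digit p (2 * of_nat s) 1 = 1"
      using less p_gt_2 a' by (intro hensel_digit_1_eq[of a _ 0]) (auto intro: p_integral_0)
    ultimately have "2 * of_nat (hensel_digit p (1 / 2 * of_nat a) 1)
        + of_nat (hensel_digit p (2 * of_nat s) 1) = of_nat p * (1 :: rat)"
      by (simp add: p')
    then show ?thesis
      unfolding s_def a_def using pcong_0_mult[OF p_integral_1] by simp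
  qed
qed

section \<open>Binomial coefficients, the Fermat quotient and Bernoulli numbers modulo p\<close>

text \<open>Pascal's rule for C(p,j+1), which p divides, makes consecutive C(p-1,j) negatives of
  each other.\<close>

lemma binomial_pcong:
  "j < p \<Longrightarrow> of_nat (p - 1 choose j) \<simeq> (-1) ^ j"
proof (induction j)
  case (Suc j)
  have "p dvd p choose Suc j"
    using Suc.prems prime_p by (intro dvd_choose_prime) auto
  then obtain c where c: "p choose Suc j = p * c" ..
  have "p choose Suc j = (p - 1 choose j) + (p - 1 choose Suc j)"
    using p_gt_2 binomial_Suc_Suc[of "p - 1" j] by simp
  then have "of_nat (p - 1 choose Suc j) = of_nat p * of_nat c + (-1) * (of_nat (p - 1 choose j) :: rat)"
    using c by (metis add.commute add_diff_cancel_left' diff_conv_add_uminus mult_minus1 of_nat_add of_nat_mult)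
  also have "\<dots> \<simeq> 0 + (-1) * (-1) ^ j"
    using Suc by (intro pcong_add pcong_0_mult pcong_mult_left p_integral_intros) auto
  finally show ?case
    by simp
qed (simp add: pcong_refl p_integral_1)

text \<open>(2^p - 2)/p is the sum of C(p,k)/p = C(p-1,k-1)/k over 0 < k < p, and C(p-1,k-1) =
  (-1)^(k-1) modulo p.\<close>

lemma fermat_quotient_pcong:
  "2 * ((2 ^ (p - 1) - 1) / of_nat p) \<simeq> - (\<Sum>k=1..p-1. (-1) ^ k / of_nat k)"
proof -
  have summand: "of_nat (p choose k) / of_nat p = of_nat (p - 1 choose (k - 1)) * (1 / of_nat k :: rat)"
    if "k \<in> {1..p-1}" for k
  proof -
    have "Suc (k - 1) = k"
      using that by simp
    then have "k * (p choose k) = p * (p - 1 choose (k - 1))"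
      using binomial_absorption[of "k - 1" p] by (simp only:)
    then have "of_nat k * of_nat (p choose k) = (of_nat p * of_nat (p - 1 choose (k - 1)) :: rat)"
      by (metis of_nat_mult)
    then show ?thesis
      using that p_gt_2 by (simp add: field_simps)
  qed
  have "(2 :: nat) ^ p = (\<Sum>k\<le>p. p choose k)"
    by (rule choose_row_sum[symmetric])
  also have "{..p} = insert 0 (insert p {1..p-1})"
    using p_gt_2 by auto
  also have "(\<Sum>k\<in>\<dots>. p choose k) = 2 + (\<Sum>k=1..p-1. p choose k)"
    using p_gt_2 by simp
  finally have "2 ^ p = 2 + (\<Sum>k=1..p-1. of_nat (p choose k) :: rat)"
    by (metis (mono_tags, lifting) of_nat_add of_nat_numeral of_nat_power of_nat_sum sum.cong)
  moreover have "(2 :: rat) ^ p = 2 * 2 ^ (p - 1)"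
    using p_gt_2 by (simp flip: power_Suc)
  ultimately have "2 * ((2 ^ (p - 1) - 1) / of_nat p) = (\<Sum>k=1..p-1. of_nat (p choose k) / of_nat p :: rat)"
    by (simp flip: sum_divide_distrib add: algebra_simps)
  also have "\<dots> = (\<Sum>k=1..p-1. of_nat (p - 1 choose (k - 1)) * (1 / of_nat k))"
    using summand by (rule sum.cong[OF refl])
  also have "\<dots> \<simeq> (\<Sum>k=1..p-1. (-1) ^ (k - 1) * (1 / of_nat k))"
    using p_gt_2 by (intro pcong_sum pcong_mult binomial_pcong pcong_refl p_integral_divide_lt p_integral_1) auto
  also have "\<dots> = - (\<Sum>k=1..p-1. (-1) ^ k / of_nat k)"
    unfolding sum_negf[symmetric] by (rule sum.cong) (auto simp: power_eq_if)
  finally show ?thesis .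
qed

text \<open>The recurrence gives (n+1) B_n as an integer combination of earlier numbers, and n + 1 <
  p is invertible.\<close>

lemma p_integral_bernoulli: "n < p - 1 \<Longrightarrow> p_integral p (bernoulli n)"
proof (induction n rule: less_induct)
  case (less n)
  show ?case
  proof (cases n)
    case 0
    then show ?thesis by (simp add: bernoulli_0 p_integral_1)
  next
    case (Suc m)
    have "(\<Sum>k\<le>n. of_nat (Suc n choose k) * bernoulli k) = 0"
      using Suc by (intro bernoulli_recurrence) simp
    then have "of_nat (Suc n) * bernoulli n = - (\<Sum>k<n. of_nat (Suc n choose k) * bernoulli k)"
      by (simp add: lessThan_Suc_atMost[symmetric] del: of_nat_Suc)
    then have "bernoulli n = - (\<Sum>k<n. of_nat (Suc n choose k) * bernoulli k) / of_nat (Suc n)"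
      by (simp add: field_simps del: of_nat_Suc)
    also have "p_integral p \<dots>"
      using less by (intro p_integral_divide_lt p_integral_minus p_integral_sum
        p_integral_mult[OF prime_p] p_integral_of_nat) auto
    finally show ?thesis .
  qed
qed

text \<open>A case of von Staudt-Clausen. In the recurrence at n = p - 1 the coefficients C(p,k)
  with 0 < k < p - 1 are divisible by p and their Bernoulli numbers are p-integral, so only 1 + p
  B_(p-1) survives.\<close>

lemma bernoulli_p_minus_1_pcong: "of_nat p * bernoulli (p - 1) \<simeq> -1"
proof -
  have p: "Suc (p - 1) = p" "Suc (p - 2) = p - 1"
    using p_gt_2 by auto
  let ?f = "\<lambda>k. of_nat (p choose k) * bernoulli k"
  have "(\<Sum>k\<le>p-1. ?f k) = 0"
    using bernoulli_recurrence[of "p - 1"] p_gt_2 p by simp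
  moreover have "{..p-1} = insert 0 (insert (p - 1) {1..p-2})"
    using p_gt_2 by auto
  moreover have "p - 1 \<notin> {1..p-2}"
    unfolding atLeastAtMost_iff using p_gt_2 by linarith
  moreover have "p choose (p - 1) = p"
    using p_gt_2 binomial_symmetric[of 1 p] by simp
  ultimately have "of_nat p * bernoulli (p - 1) = - 1 - (\<Sum>k=1..p-2. ?f k)"
    using p_gt_2 by (simp add: bernoulli_0 algebra_simps)
  also have "\<dots> \<simeq> - 1 - (\<Sum>k=1..p-2. 0)"
  proof (intro pcong_diff pcong_refl pcong_sum p_integral_intros)
    fix k
    assume k: "k \<in> {1..p-2}"
    then have "p dvd p choose k"
      using prime_p p_gt_2 by (intro dvd_choose_prime) auto
    then obtain c where "p choose k = p * c" ..
    then have "?f k = of_nat p * (of_nat c * bernoulli k)"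
      by simp
    also have "\<dots> \<simeq> 0"
      using k p_gt_2 by (intro pcong_0_mult p_integral_mult[OF prime_p] p_integral_bernoulli p_integral_of_nat) auto
    finally show "?f k \<simeq> 0" .
  qed
  finally show ?thesis
    by simp
qed

text \<open>The factor C(p-1,j) may be inserted, being 1 modulo p for even j, while B_j = 0 for odd
  j. This gives the middle part of \<open>bernoulli_half_convolution\<close> at n = p - 1.\<close>

lemma bernoulli_sum_pcong:
  assumes "p > 3"
  shows "(\<Sum>j=2..p-3. bernoulli j / 2 ^ j * bernoulli (p - 1 - j))
    \<simeq> 1 - (\<Sum>k=1..p-1. (-1) ^ k / of_nat k) / 2"
proof -
  let ?A = "\<Sum>k=1..p-1. (-1) ^ k / of_nat k :: rat"
  let ?f = "\<lambda>j. bernoulli j / 2 ^ j * bernoulli (p - 1 - j)"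
  let ?g = "\<lambda>j. of_nat (p - 1 choose j) * ?f j"
  define q :: rat where "q = (2 ^ (p - 1) - 1) / of_nat p"
  have p: "p \<ge> 5" "odd (p - 2)"
  proof -
    have "p \<noteq> 4"
      using odd_p by auto
    then show "p \<ge> 5"
      using assms by simp
    show "odd (p - 2)"
      using assms odd_p by simp
  qed
  have q: "q \<simeq> - ?A / 2"
    using pcong_mult_left[OF p_integral_divide_2[OF p_integral_1] fermat_quotient_pcong]
    unfolding q_def[symmetric] by simp
  have q': "2 ^ (p - 1) = 1 + of_nat p * q"
    using p by (simp add: q_def)
  have "?f j \<simeq> ?g j" if j: "j \<in> {2..p-3}" for j
  proof (cases "even j")
    case True
    have int: "p_integral p (?f j)"
      using j by (intro p_integral_mult[OF prime_p] p_integral_divide_2_power p_integral_bernoulli) auto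
    have "(-1) ^ j * ?f j \<simeq> ?g j"
      using j int p by (intro pcong_mult pcong_refl pcong_sym[OF binomial_pcong]) auto
    with True show ?thesis
      by simp
  next
    case False
    then have "bernoulli j = 0"
      using j by (intro bernoulli_odd_eq_0) auto
    then show ?thesis
      by (simp add: pcong_refl p_integral_0)
  qed
  then have "(\<Sum>j=2..p-3. ?f j) \<simeq> (\<Sum>j=2..p-3. ?g j)"
    by (rule pcong_sum)
  \<comment> \<open>The terms j = 0 and j = p-1 are B_(p-1) and B_(p-1)/2^(p-1); those at 1 and p-2
    contain B_(p-2) = 0. Removing them leaves -B_(p-1) (2^(p-1) + p - 1)/2^(p-1), where 2^(p-1) + p
    - 1 = p (1 + q).\<close>
  also have "(\<Sum>j=2..p-3. ?g j) = - (of_nat p * bernoulli (p - 1)) * (1 + q) * (1 / 2 ^ (p - 1))"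
  proof -
    have odd0: "bernoulli (p - 2) = 0"
      using p by (intro bernoulli_odd_eq_0) auto
    have diff: "p - 1 - (p - 2) = 1" "p - 1 - 1 = p - 2" "p - Suc (Suc 0) = p - 2"
      using p by auto
    have "(\<Sum>j\<le>p-1. F j) = F 0 + (F 1 + (F (p - 2) + (F (p - 1) + (\<Sum>j=2..p-3. F j))))"
      for F :: "nat \<Rightarrow> rat"
    proof -
      have "{..p-1} = insert 0 (insert 1 (insert (p - 2) (insert (p - 1) {2..p-3})))"
        using p by auto
      moreover have "0 \<notin> insert 1 (insert (p - 2) (insert (p - 1) {2..p-3}))"
          "1 \<notin> insert (p - 2) (insert (p - 1) {2..p-3})"
          "p - 2 \<notin> insert (p - 1) {2..p-3}" "p - 1 \<notin> {2..p-3}"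
        unfolding insert_iff atLeastAtMost_iff using p(1) by linarith+
      ultimately show ?thesis
        by (simp only: sum.insert finite_insert finite_atLeastAtMost not_False_eq_True)
    qed
    then have "(\<Sum>j\<le>p-1. ?g j) = ?g 0 + (?g 1 + (?g (p - 2) + (?g (p - 1) + (\<Sum>j=2..p-3. ?g j))))" .
    also have "\<dots> = bernoulli (p - 1) * (1 + 1 / 2 ^ (p - 1)) + (\<Sum>j=2..p-3. ?g j)"
      using odd0 unfolding diff by (simp add: bernoulli_0 diff algebra_simps)
    also have "(\<Sum>j\<le>p-1. ?g j) = - (of_nat (p - 1) - 1) * bernoulli (p - 1) / 2 ^ (p - 1)"
    proof -
      have "1 \<le> p - 1"
        using p by simp
      from bernoulli_half_convolution[OF this] show ?thesis
        unfolding diff odd0 by simp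
    qed
    finally have "(\<Sum>j=2..p-3. ?g j) = - bernoulli (p - 1) * (2 ^ (p - 1) + of_nat (p - 1)) * (1 / 2 ^ (p - 1))"
      by (simp add: field_simps)
    then show ?thesis
      using p unfolding q' by (simp add: algebra_simps)
  qed
  also have "\<dots> \<simeq> - (- 1) * (1 + - ?A / 2) * 1"
  proof (intro pcong_mult pcong_minus bernoulli_p_minus_1_pcong pcong_add pcong_refl p_integral_1 q)
    \<comment> \<open>Fermat's little theorem in explicit form, \<open>q\<close> being
      p-integral.\<close>
    have "of_nat p * (- q / 2 ^ (p - 1)) = (1 - 2 ^ (p - 1)) / 2 ^ (p - 1)"
      unfolding q' by simp
    then have "1 / 2 ^ (p - 1) = 1 + of_nat p * (- q / 2 ^ (p - 1))"
      by (simp add: diff_divide_distrib)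
    then show "1 / 2 ^ (p - 1) \<simeq> 1"
      using pcong_integral(1)[OF q] by (intro pcongI[of _ "- q / 2 ^ (p - 1)"] p_integral_1 p_integral_divide_2_power p_integral_minus)
  qed
  finally show ?thesis
    by simp
qed

section \<open>Sums over odd indices, in terms of A modulo p\<close>

text \<open>\<open>sum_partial_sums_odd\<close> turns each sum into weighted sums up to p - 1. What
  does not vanish modulo p comes from h = -1/2, from A, and from W with 4 W = A^2.\<close>

lemma harmonic_sums_pcong:
  assumes h: "p = 2 * h + 1" and "p > 3"
  defines "A \<equiv> \<Sum>k=1..p-1. (-1) ^ k / of_nat k"
  shows "(\<Sum>m<h. harmonic (2 * m + 1)) \<simeq> 1 / 2 - A / 4" (is ?S)
    and "(\<Sum>m<h. gen_harmonic 2 (2 * m + 1)) \<simeq> 0" (is ?R)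
    and "(\<Sum>m<h. harmonic (2 * m + 1) ^ 2) \<simeq> -1 - A ^ 2 / 8" (is ?Q)
proof -
  let ?H = "harmonic (2 * h)" and ?G = "gen_harmonic 2 (2 * h)"
  let ?c = "of_nat (4 * h + 1) / 4 :: rat"
  define W where "W = (\<Sum>k=1..2*h. (-1) ^ k * harmonic (k - 1) / of_nat k)"
  define Z :: rat where "Z = (\<Sum>k=1..2*h. (-1) ^ k / of_nat k ^ 2)"
  have A: "A = (\<Sum>k=1..2*h. (-1) ^ k / of_nat k)"
    by (simp add: A_def h)
  have H: "?H \<simeq> 0" and G: "?G \<simeq> 0" and Z: "Z \<simeq> 0"
    using harmonic_pcong_0 gen_harmonic_2_pcong_0[OF \<open>p > 3\<close>] alternating_square_sum_pcong_0
    by (simp_all add: h Z_def)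
  have "A ^ 2 \<simeq> 4 * W"
    using alternating_harmonic_square[OF \<open>p > 3\<close>] by (simp add: A_def W_def h)
  then have W: "1 / 4 * A ^ 2 \<simeq> 1 / 4 * (4 * W)"
    by (intro pcong_mult_left p_integral_intros)
  have "p_integral p ((-1) ^ k / of_nat k)" if "k \<in> {1..2*h}" for k
    using that by (intro p_integral_divide_lt p_integral_power p_integral_minus p_integral_1) (auto simp: h)
  then have A_int: "p_integral p A"
    unfolding A by (rule p_integral_sum)
  have c_int: "p_integral p ?c"
    by (intro p_integral_intros)
  have "of_nat h = (of_nat p - 1 :: rat) / 2"
    by (simp add: h)
  then have mod_h: "of_nat h \<simeq> - (1 / 2)"
    by (intro pcongI[of _ "1 / 2"] p_integral_intros) (simp add: field_simps)

  have "(\<Sum>m<h. harmonic (2 * m + 1)) = (\<Sum>k=1..2*h. (of_nat (4 * h + 1) - 2 * of_nat k - (-1) ^ k) / 4 * (1 / of_nat k))"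
    unfolding harmonic_def by (rule sum_partial_sums_odd)
  \<comment> \<open>The part -2k of the weight contributes -1/2 for each of the 2h indices, hence
    -h, congruent to 1/2.\<close>
  also have "\<dots> = (\<Sum>k=1..2*h. ?c * (1 / of_nat k) - 1 / 2 - (-1) ^ k / of_nat k / 4)"
    by (rule sum.cong) (auto simp: field_simps)
  also have "\<dots> = ?c * ?H - of_nat h - A / 4"
    by (simp add: sum_subtractf harmonic_def A sum_distrib_left sum_divide_distrib)
  also have "\<dots> \<simeq> ?c * 0 - - (1 / 2) - A / 4"
    using A_int by (intro pcong_diff pcong_mult_left c_int H mod_h pcong_refl p_integral_divide_4)
  finally show ?S
    by simp

  have "(\<Sum>m<h. gen_harmonic 2 (2 * m + 1)) = (\<Sum>k=1..2*h. (of_nat (4 * h + 1) - 2 * of_nat k - (-1) ^ k) / 4 * (1 / of_nat k ^ 2))"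
    unfolding gen_harmonic_def by (rule sum_partial_sums_odd)
  also have "\<dots> = (\<Sum>k=1..2*h. ?c * (1 / of_nat k ^ 2) - 1 / 2 * (1 / of_nat k) - 1 / 4 * ((-1) ^ k / of_nat k ^ 2))"
    by (rule sum.cong) (auto simp: field_simps power2_eq_square)
  also have "\<dots> = ?c * ?G - 1 / 2 * ?H - 1 / 4 * Z"
    by (simp only: sum_subtractf harmonic_def gen_harmonic_def Z_def sum_distrib_left)
  also have "\<dots> \<simeq> ?c * 0 - 1 / 2 * 0 - 1 / 4 * 0"
    by (intro pcong_diff pcong_mult_left c_int H G Z p_integral_intros)
  finally show ?R
    by simp

  let ?a = "\<lambda>k. 2 * harmonic (k - 1) / of_nat k + 1 / of_nat k ^ 2"
  have "(\<Sum>m<h. harmonic (2 * m + 1) ^ 2) = (\<Sum>k=1..2*h. (of_nat (4 * h + 1) - 2 * of_nat k - (-1) ^ k) / 4 * ?a k)"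
    unfolding square_harmonic by (rule sum_partial_sums_odd)
  also have "\<dots> = (\<Sum>k=1..2*h. ?c * ?a k - harmonic (k - 1) - 1 / 2 * (1 / of_nat k)
      - 1 / 2 * ((-1) ^ k * harmonic (k - 1) / of_nat k) - 1 / 4 * ((-1) ^ k / of_nat k ^ 2))"
    by (rule sum.cong) (auto simp: field_simps power2_eq_square)
  also have "\<dots> = ?c * ?H ^ 2 - (\<Sum>k=1..2*h. harmonic (k - 1)) - 1 / 2 * ?H - 1 / 2 * W - 1 / 4 * Z"
    by (simp only: sum_subtractf square_harmonic W_def Z_def sum_distrib_left) (simp only: harmonic_def sum_distrib_left)
  \<comment> \<open>\<open>sum_harmonic\<close> leaves the constant 2h, congruent to -1;
    \<open>W\<close> is written as \<open>1 / 4 * (4 * W)\<close> to match its congruence with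
    A^2/4.\<close>
  also have "\<dots> = ?c * ?H ^ 2 - 2 * of_nat h * ?H + 2 * of_nat h - 1 / 2 * ?H - 1 / 2 * (1 / 4 * (4 * W)) - 1 / 4 * Z"
    unfolding sum_harmonic by simp
  also have "\<dots> \<simeq> ?c * 0 ^ 2 - 2 * of_nat h * 0 + 2 * - (1 / 2) - 1 / 2 * 0 - 1 / 2 * (1 / 4 * A ^ 2) - 1 / 4 * 0"
    by (intro pcong_add pcong_diff pcong_mult_left pcong_power c_int H Z mod_h pcong_sym[OF W] p_integral_intros)
  also have "?c * 0 ^ 2 - 2 * of_nat h * 0 + 2 * - (1 / 2) - 1 / 2 * 0 - 1 / 2 * (1 / 4 * A ^ 2) - 1 / 4 * 0
      = -1 - A ^ 2 / 8"
    by simp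
  finally show ?Q .
qed

end

section \<open>Comparison of the two sides through A\<close>

theorem theorem1:
  fixes p :: nat
  assumes "prime p" and "p \<ge> 5"
  shows "let S = (\<Sum>m | m \<in> {1..p-1} \<and> odd m. harmonic m) in
    p_cong p 1
      (\<Sum>j=2..p-3. bernoulli j / 2 ^ j * bernoulli (p - 1 - j))
      (- 1
       + 2 * of_nat (hensel_digit p (1 / 2 * of_nat (hensel_digit p (2 * S) 0)) 1)
       + of_nat (hensel_digit p (2 * of_nat (hensel_digit p S 0)) 1)
       + 6 * S
       + 4 * (\<Sum>m=1..(p-3) div 2. gen_harmonic 2 (2 * m))
       - 4 * (\<Sum>m=1..(p-3) div 2. harmonic (2 * m) * harmonic (2 * m + 1))
       - 4 * S ^ 2
       + 2 * (\<Sum>m=2..(p-3) div 2. \<Sum>i=1..2*m-1. harmonic i / of_nat (2 * m - i)))"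
proof -
  have "odd p"
    using assms prime_odd_nat by simp
  then interpret odd_prime p
    using assms(1) by unfold_locales
  define h where "h = p div 2"
  have h: "p = 2 * h + 1"
    using \<open>odd p\<close> by (simp add: h_def)
  have h2: "h \<ge> 2" "(p - 3) div 2 = h - 1"
    using assms(2) by (auto simp: h)
  have "p > 3"
    using assms(2) by simp
  define S where "S = (\<Sum>m | m \<in> {1..p-1} \<and> odd m. harmonic m)"
  define A :: rat where "A = (\<Sum>k=1..p-1. (-1) ^ k / of_nat k)"
  define R where "R = (\<Sum>m<h. gen_harmonic 2 (2 * m + 1))"
  define Q where "Q = (\<Sum>m<h. harmonic (2 * m + 1) ^ 2)"
  have "S = (\<Sum>m<h. harmonic (2 * m + 1))"
    unfolding S_def
    by (rule sum.reindex_bij_witness[of _ "\<lambda>m. 2 * m + 1" "\<lambda>m. m div 2"]) (auto simp: h elim!: oddE)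
  then have S: "S \<simeq> 1 / 2 - A / 4" and R: "R \<simeq> 0" and Q: "Q \<simeq> -1 - A ^ 2 / 8"
    using harmonic_sums_pcong[OF h \<open>p > 3\<close>] by (simp_all only: A_def R_def Q_def)
  let ?d = "2 * of_nat (hensel_digit p (1 / 2 * of_nat (hensel_digit p (2 * S) 0)) 1)
       + of_nat (hensel_digit p (2 * of_nat (hensel_digit p S 0)) 1) :: rat"
  have d: "?d \<simeq> 0"
    using pcong_integral(1)[OF S] by (rule hensel_carries_pcong_0)
  have "(\<Sum>j=2..p-3. bernoulli j / 2 ^ j * bernoulli (p - 1 - j)) \<simeq> 1 - A / 2"
    unfolding A_def using \<open>p > 3\<close> by (rule bernoulli_sum_pcong)
  \<comment> \<open>The terms in A^2 from 4 S^2 and from 2 Q cancel, and the rest is linear in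
    A.\<close>
  also have "1 - A / 2 = - 1 + 0 + 6 * (1 / 2 - A / 4) - 4 * (1 / 2 - A / 4) ^ 2
      + (2 * 0 - 2 * (-1 - A ^ 2 / 8) - 2)"
    by (simp add: power2_eq_square field_simps)
  also have "\<dots> \<simeq> - 1 + ?d + 6 * S - 4 * S ^ 2 + (2 * R - 2 * Q - 2)"
    by (intro pcong_add pcong_diff pcong_mult_left pcong_power pcong_sym[OF d] pcong_sym[OF S]
      pcong_sym[OF R] pcong_sym[OF Q] pcong_refl p_integral_intros)
  \<comment> \<open>Read backwards, \<open>even_index_sums_eq_odd_index_sums\<close> restores the
    original sums, with (p-3)/2 as \<open>h - 1\<close>.\<close>
  finally show ?thesis
    unfolding Let_def S_def[symmetric] pcong_def R_def Q_def even_index_sums_eq_odd_index_sums[OF h2(1), symmetric] h2(2)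
    by (simp add: algebra_simps)
qed

end
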